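(* Let $N\ge 2$ be an integer, let $V>g>0$ be real numbers, and suppose $r_1=r_2=0$. Let $b=(b_1,\dots,b_N)$ be a pure strategy profile of the auction game, with agents ordered so that $b_1\le b_2\le\dots\le b_N$ (where an abstention is treated, for the purposes of this ordering, as a bid less than zero). Then $b$ is a Nash equilibrium in pure strategies if and only if $b_{N-1}=b_N=V-g$.
   Context: Auction game. $N\ge2$ agents $i\in[N]=\{1,\dots,N\}$ compete for a single opportunity of common value $V>0$; $g>0$ is the base fee, with $V>g$; $r_1,r_2\in[0,1]$ are the revert penalty rates on the base fee and the priority fee. Each agent $i$ chooses an action $b_i\in\mathcal B=\{\varnothing\}\cup[0,\infty)$, where $\varnothing$ means abstaining and $b_i\ge0$ is a priority-fee bid. The winner $w$ is the participating agent with the highest bid, ties being broken uniformly at random among the highest bids: for $b_i\ge 0$, $$\mathbb P(w=i\mid b)=\frac{\mathbf 1\{b_i=b_M\}}{1+\sum_{j\ne i}\mathbf 1\{b_j=b_i\}},\qquad b_M=\max\{b_j: b_j\ge0\}.$$ The payoff of agent $i$ is $$u_i(b_i\mid b_{-i})=(V-g-b_i)\,\mathbb P(w=i\mid b)-(r_1g+r_2b_i)\bigl(1-\mathbb P(w=i\mid b)\bigr)\quad\text{if } b_i\ge0,$$ and $u_i(b_i\mid b_{-i})=0$ if $b_i=\varnothing$. A pure strategy profile $b^*$ is a Nash equilibrium if $u_i(b_i^*\mid b_{-i}^* )\ge u_i(b_i\mid b^*_{-i})$ for all $i\in[N]$ and all $b_i\in\mathcal B$. *)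

theory Defs
  imports Complex_Main "HOL-Library.FuncSet" "HOL-Library.Option_ord"
begin

text \<open>
  An action is \<open>None\<close> (abstain) or \<open>Some x\<close> (a priority-fee bid \<open>x\<close>). The library order on options
  has \<open>None\<close> strictly below every \<open>Some x\<close>, i.e. it ranks an abstention as a bid less than zero.
  The agents are \<open>{1..N}\<close>; values of a profile outside this set are irrelevant.
\<close>

definition actions :: "real option set" where
  "actions = insert None (Some ` {0..})"

definition profiles :: "nat \<Rightarrow> (nat \<Rightarrow> real option) set" where
  "profiles N = {1..N} \<rightarrow> actions"

text \<open>Only meaningful if some agent participates.\<close>

definition max_bid :: "nat \<Rightarrow> (nat \<Rightarrow> real option) \<Rightarrow> real" where
  "max_bid N b = Max {x. \<exists>j\<in>{1..N}. b j = Some x}"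

definition win_prob :: "nat \<Rightarrow> (nat \<Rightarrow> real option) \<Rightarrow> nat \<Rightarrow> real" where
  "win_prob N b i =
    (case b i of
       None \<Rightarrow> 0
     | Some x \<Rightarrow> of_bool (x = max_bid N b) / (1 + (\<Sum>j\<in>{1..N} - {i}. of_bool (b j = Some x))))"

definition payoff ::
  "nat \<Rightarrow> real \<Rightarrow> real \<Rightarrow> real \<Rightarrow> real \<Rightarrow> (nat \<Rightarrow> real option) \<Rightarrow> nat \<Rightarrow> real" where
  "payoff N V g r1 r2 b i =
    (case b i of
       None \<Rightarrow> 0
     | Some x \<Rightarrow> (V - g - x) * win_prob N b i - (r1 * g + r2 * x) * (1 - win_prob N b i))"

definition pure_nash ::
  "nat \<Rightarrow> real \<Rightarrow> real \<Rightarrow> real \<Rightarrow> real \<Rightarrow> (nat \<Rightarrow> real option) \<Rightarrow> bool" where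
  "pure_nash N V g r1 r2 b \<longleftrightarrow>
    b \<in> profiles N \<and>
    (\<forall>i\<in>{1..N}. \<forall>a\<in>actions. payoff N V g r1 r2 b i \<ge> payoff N V g r1 r2 (b(i := a)) i)"

end

theory Submission
  imports Defs
begin

text \<open>
  With no penalties an agent bidding \<open>x\<close> gets \<open>(V - g - x)\<close> times the winning probability. This is
  Bertrand competition: if the top bid is below \<open>V - g\<close>, agent \<open>N - 1\<close> wins with
  probability at most \<open>1/2\<close> and profits from overbidding by a third of the gap; if it is above,
  the top agent prefers to abstain; if only the top agent bids \<open>V - g\<close>, lowering that bid to a
  value still above the others turns a zero payoff into a positive one.
\<close>

text \<open>Needed for the rules on \<open>Max\<close>. Each bid is the image of an agent under
  \<open>the\<close> after \<open>b\<close>, and there are finitely many agents.\<close>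

lemma finite_bids: "finite {x. \<exists>j\<in>{1..N::nat}. b j = Some x}"
  by (rule finite_subset[of _ "(\<lambda>j. the (b j)) ` {1..N}"]) (auto simp: image_iff, force)

lemma max_bid_ge:
  assumes "j \<in> {1..N}" "b j = Some x"
  shows "x \<le> max_bid N b"
  unfolding max_bid_def by (rule Max_ge[OF finite_bids]) (use assms in blast)

text \<open>Bounding by \<open>Some x\<close> in the order on options treats abstaining agents
  uniformly, as \<open>None\<close> lies below every bid.\<close>

lemma max_bid_eqI:
  assumes "i \<in> {1..N}" "b i = Some x" "\<And>j. j \<in> {1..N} \<Longrightarrow> b j \<le> Some x"
  shows "max_bid N b = x"
  unfolding max_bid_def
proof (rule Max_eqI[OF finite_bids])
  show "y \<le> x" if "y \<in> {x. \<exists>j\<in>{1..N}. b j = Some x}" for y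
    using that assms(3) by force
qed (use assms in blast)

lemma win_prob_nonneg: "0 \<le> win_prob N b i"
  unfolding win_prob_def by (auto split: option.split intro!: divide_nonneg_nonneg add_nonneg_nonneg sum_nonneg)

lemma win_prob_pos:
  assumes "b i = Some (max_bid N b)"
  shows "0 < win_prob N b i"
proof -
  have "0 \<le> (\<Sum>j\<in>{1..N} - {i}. of_bool (b j = Some (max_bid N b)) :: real)"
    by (rule sum_nonneg) simp
  then show ?thesis
    using assms by (simp add: win_prob_def)
qed

lemma win_prob_outbid:
  assumes "j \<in> {1..N}" "b j = Some y" "b i = Some x" "x < y"
  shows "win_prob N b i = 0"
  using max_bid_ge[of j N b y] assms by (simp add: win_prob_def)

lemma win_prob_sole:
  assumes "i \<in> {1..N}" "b i = Some x" "\<And>j. j \<in> {1..N} - {i} \<Longrightarrow> b j < Some x"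
  shows "win_prob N b i = 1"
proof -
  have "max_bid N b = x"
    using assms by (intro max_bid_eqI) (auto simp: le_less)
  moreover have "(\<Sum>j\<in>{1..N} - {i}. of_bool (b j = Some x)) = (0::real)"
    using assms(3) by (intro sum.neutral) fastforce
  ultimately show ?thesis
    using assms(2) by (simp add: win_prob_def)
qed

text \<open>A tie with \<open>j\<close> makes the denominator at least 2; a higher bid of
  \<open>j\<close>, or abstaining, leaves no chance at all.\<close>

lemma win_prob_not_sole:
  assumes "j \<in> {1..N}" "j \<noteq> i" "b i \<le> b j"
  shows "win_prob N b i \<le> 1 / 2"
proof (cases "b i")
  case None
  then show ?thesis by (simp add: win_prob_def)
next
  case (Some x)
  with assms(3) obtain y where y: "b j = Some y" "x \<le> y"
    by (cases "b j") auto
  show ?thesis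
  proof (cases "x = y")
    case True
    have "of_bool (b j = Some x) \<le> (\<Sum>k\<in>{1..N} - {i}. of_bool (b k = Some x) :: real)"
      by (rule member_le_sum) (use assms in auto)
    then show ?thesis
      using Some y True by (auto simp: win_prob_def divide_simps)
  next
    case False
    then show ?thesis
      using win_prob_outbid[of j N b y i x] assms(1) Some y by simp
  qed
qed

lemma payoff_no_penalty:
  "payoff N V g 0 0 b i = (case b i of None \<Rightarrow> 0 | Some x \<Rightarrow> (V - g - x) * win_prob N b i)"
  by (simp add: payoff_def split: option.split)

lemma pure_nashD:
  assumes "pure_nash N V g r1 r2 b" "i \<in> {1..N}" "a \<in> actions"
  shows "payoff N V g r1 r2 (b(i := a)) i \<le> payoff N V g r1 r2 b i"
  using assms by (auto simp: pure_nash_def)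

lemma Some_in_actions: "Some x \<in> actions \<longleftrightarrow> 0 \<le> x"
  by (auto simp: actions_def)

lemma payoff_sole_deviation:
  assumes "i \<in> {1..N}" "\<And>j. j \<in> {1..N} - {i} \<Longrightarrow> b j < Some x"
  shows "payoff N V g 0 0 (b(i := Some x)) i = V - g - x"
  using win_prob_sole[of i N "b(i := Some x)" x] assms by (simp add: payoff_no_penalty)

text \<open>A bid above all rivals wins with certainty and earns its full margin, so an equilibrium
  payoff cannot be smaller. Every deviation to a bid used for necessity enters through this
  bound.\<close>

lemma nash_no_penalty_lower_bound:
  assumes "pure_nash N V g 0 0 b" "i \<in> {1..N}" "0 \<le> x"
    and "\<And>j. j \<in> {1..N} - {i} \<Longrightarrow> b j < Some x"
  shows "V - g - x \<le> payoff N V g 0 0 b i"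
  using pure_nashD[OF assms(1,2), of "Some x"] payoff_sole_deviation[OF assms(2), of b x V g] assms(3,4)
  by (simp add: Some_in_actions)

lemma nash_no_penalty_top_two:
  assumes N: "N \<ge> 2" and gV: "g < V" and mono: "mono_on {1..N} b"
    and nash: "pure_nash N V g 0 0 b"
  shows "b (N - 1) = Some (V - g) \<and> b N = Some (V - g)"
proof -
  have top: "b j \<le> b N" if "j \<in> {1..N}" for j
    using mono_onD[OF mono, of j N] that N by auto
  have second: "b j \<le> b (N - 1)" if "j \<in> {1..N} - {N}" for j
    using mono_onD[OF mono, of j "N - 1"] that N by auto
  have ranges: "N \<in> {1..N}" "N - 1 \<in> {1..N}" "N - 1 \<noteq> N"
    using N by auto
  have bids: "b j \<in> actions" if "j \<in> {1..N}" for j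
    using nash that by (auto simp: pure_nash_def profiles_def)
  obtain M where M: "b N = Some M"
  proof (cases "b N")
    case None
    \<comment> \<open>If the highest agent abstains, so does everyone, and any bid strictly below
      \<open>V - g\<close> would win a positive margin unopposed.\<close>
    define x where "x = (V - g) / 2"
    have "b j < Some x" if "j \<in> {1..N} - {N}" for j
      using top[of j] that None by (cases "b j") auto
    then have "V - g - x \<le> payoff N V g 0 0 b N"
      using gV by (intro nash_no_penalty_lower_bound nash ranges) (auto simp: x_def)
    then show ?thesis
      using None gV by (simp add: payoff_no_penalty x_def)
  qed
  have M0: "0 \<le> M"
    using bids[OF ranges(1)] M by (simp add: Some_in_actions)
  have max: "max_bid N b = M"
    using top M ranges by (intro max_bid_eqI[of N]) auto
  have "\<not> M > V - g"
  proof
    assume "M > V - g"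
    then have "payoff N V g 0 0 b N < 0"
      using win_prob_pos[of b N N] M max by (simp add: payoff_no_penalty mult_neg_pos)
    moreover have "0 \<le> payoff N V g 0 0 b N"
      using pure_nashD[OF nash ranges(1), of None] by (simp add: actions_def payoff_no_penalty)
    ultimately show False by simp
  qed
  moreover have "\<not> M < V - g"
  proof
    assume less: "M < V - g"
    \<comment> \<open>Overbidding by a third of the gap keeps two thirds of it as a sure margin,
      more than the half that bounds the current payoff of agent \<open>N - 1\<close>.\<close>
    define x where "x = M + (V - g - M) / 3"
    have "b j < Some x" if "j \<in> {1..N}" for j
      using top[OF that] M less by (auto simp: x_def elim: le_less_trans)
    then have "V - g - x \<le> payoff N V g 0 0 b (N - 1)"
      using less M0 by (intro nash_no_penalty_lower_bound nash ranges) (auto simp: x_def)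
    also have "\<dots> \<le> (V - g - M) / 2"
    proof (cases "b (N - 1)")
      case None
      then show ?thesis using less by (simp add: payoff_no_penalty)
    next
      case (Some y)
      show ?thesis
      proof (cases "y = M")
        case True
        have "win_prob N b (N - 1) \<le> 1 / 2"
          using top ranges by (intro win_prob_not_sole[of N]) auto
        then have "(V - g - M) * win_prob N b (N - 1) \<le> (V - g - M) * (1 / 2)"
          using less by (intro mult_left_mono) auto
        then show ?thesis using Some True by (simp add: payoff_no_penalty)
      next
        case False
        then have "y < M" using top[OF ranges(2)] Some M by simp
        then show ?thesis
          using win_prob_outbid[OF ranges(1) M Some] Some less by (simp add: payoff_no_penalty)
      qed
    qed
    finally show False using less by (simp add: x_def field_simps)
  qed
  ultimately have MV: "M = V - g" by simp
  have "b (N - 1) = Some (V - g)"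
  proof (rule ccontr)
    assume neq: "b (N - 1) \<noteq> Some (V - g)"
    have lt: "b (N - 1) < Some (V - g)"
      using neq top[OF ranges(2)] M MV by (simp add: le_less)
    \<comment> \<open>Such a bid still beats all rivals of agent \<open>N\<close>, since
      \<open>b (N - 1)\<close> is the highest among them. The midpoint serves when
      \<open>N - 1\<close> bids; an abstention has no midpoint and is treated apart.\<close>
    have "\<exists>x. 0 \<le> x \<and> x < V - g \<and> b (N - 1) < Some x"
    proof (cases "b (N - 1)")
      case None
      then show ?thesis using gV by auto
    next
      case (Some y)
      then have "0 \<le> y" "y < V - g"
        using bids[OF ranges(2)] lt by (simp_all add: Some_in_actions)
      then show ?thesis
        using Some by (intro exI[of _ "(y + (V - g)) / 2"]) (simp add: field_simps)
    qed
    then obtain x where x: "0 \<le> x" "x < V - g" "b (N - 1) < Some x" by blast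
    have "V - g - x \<le> payoff N V g 0 0 b N"
      using second x by (intro nash_no_penalty_lower_bound nash ranges) (auto intro: le_less_trans)
    then show False
      using x M MV by (simp add: payoff_no_penalty)
  qed
  then show ?thesis using M MV by simp
qed

text \<open>A bid below \<open>V - g\<close> loses to the rival, and one at or above it has no
  positive margin. As \<open>b i\<close> is arbitrary, this bounds all deviations of
  \<open>i\<close> at once.\<close>

lemma payoff_nonpos_if_rival_bids_value:
  assumes "j \<in> {1..N}" "j \<noteq> i" "b j = Some (V - g)"
  shows "payoff N V g 0 0 b i \<le> 0"
proof (cases "b i")
  case None
  then show ?thesis by (simp add: payoff_no_penalty)
next
  case (Some x)
  show ?thesis
  proof (cases "x < V - g")
    case True
    then show ?thesis
      using win_prob_outbid[OF assms(1,3) Some] Some by (simp add: payoff_no_penalty)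
  next
    case False
    then show ?thesis
      using Some win_prob_nonneg[of N b i] by (simp add: payoff_no_penalty mult_nonpos_nonneg)
  qed
qed

lemma nash_no_penalty_if_top_two:
  assumes N: "N \<ge> 2" and prof: "b \<in> profiles N" and mono: "mono_on {1..N} b"
    and b: "b (N - 1) = Some (V - g)" "b N = Some (V - g)"
  shows "pure_nash N V g 0 0 b"
  unfolding pure_nash_def
proof (intro conjI ballI prof)
  fix i a
  assume i: "i \<in> {1..N}"
  \<comment> \<open>Having two agents at \<open>V - g\<close> guarantees a rival \<open>j\<close>
    whose bid stays there whichever agent \<open>i\<close> deviates.\<close>
  define j where "j = (if i = N then N - 1 else N)"
  have j: "j \<in> {1..N}" "j \<noteq> i" "b j = Some (V - g)"
    using N b by (auto simp: j_def)
  have "payoff N V g 0 0 (b(i := a)) i \<le> 0"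
    using j by (intro payoff_nonpos_if_rival_bids_value[of j]) auto
  \<comment> \<open>By the ordering no bid exceeds \<open>V - g\<close>, so no agent has a negative
    margin.\<close>
  also have "0 \<le> payoff N V g 0 0 b i"
  proof (cases "b i")
    case None
    then show ?thesis by (simp add: payoff_no_penalty)
  next
    case (Some x)
    moreover have "b i \<le> b N"
      using mono_onD[OF mono, of i N] i by auto
    ultimately have "x \<le> V - g"
      using b by simp
    then show ?thesis
      using Some win_prob_nonneg[of N b i] by (simp add: payoff_no_penalty)
  qed
  finally show "payoff N V g 0 0 (b(i := a)) i \<le> payoff N V g 0 0 b i" .
qed

theorem theorem3p1:
  fixes N :: nat and V g r1 r2 :: real and b :: "nat \<Rightarrow> real option"
  assumes "N \<ge> 2"
    and "0 < g" and "g < V"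
    and "r1 = 0" and "r2 = 0"
    and "b \<in> profiles N"
    and "mono_on {1..N} b"
  shows "pure_nash N V g r1 r2 b \<longleftrightarrow> b (N - 1) = Some (V - g) \<and> b N = Some (V - g)"
  using assms nash_no_penalty_top_two nash_no_penalty_if_top_two by blast

end
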